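(* Let $G$ be a connected graph with $\mathsf{td}(G) = 3$. Then $\mathsf{mtd}(G) = 3$ if and only if $G$ contains none of $C_4$, $P_6$, $T_{3,3}$ as an induced subgraph.
   Context: $C_4$ is the 4-cycle, $P_6$ the path on 6 vertices, and $T_{3,3}$ the $(3,3)$-tadpole graph: a triangle $abc$ together with a path $a - x - y - z$ (6 vertices, 7 edges). An elimination tree of a connected graph $G$ is a rooted tree $(T,r)$ with $r\in V(G)$ whose root-subtrees are, recursively, elimination trees of the connected components of $G - r$; its depth is the maximum number of vertices on a root-to-leaf path; $\mathsf{td}(G)$ is the minimum depth of an elimination tree. A matched elimination tree is an elimination tree such that for every root-to-leaf path $(v_1,\dots,v_k)$: if $k$ is even, $v_1v_2, v_3v_4,\dots,v_{k-1}v_k$ are edges of $G$; if $k$ is odd, the sequence splits into consecutive blocks, all of size 2 except exactly one of size 3, where each size-2 block $(v_j,v_{j+1})$ has $v_jv_{j+1}\in E(G)$ and the size-3 block $(v_j,v_{j+1},v_{j+2})$ has $v_jv_{j+1},v_{j+1}v_{j+2}\in E(G)$. $\mathsf{mtd}(G)$ is the minimum depth of a matched elimination tree. *)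

theory Defs
  imports
    "Graph_Theory.Digraph_Component"
    "Graph_Theory.Digraph_Isomorphism"
    "HOL-Library.FSet"
    "HOL-Library.Extended_Nat"
begin

text \<open>
  Finite simple graphs are the library's \<open>graph\<close>s, i.e. finite symmetric digraphs without loops
  and parallel arcs, so that \<open>u \<rightarrow>\<^bsub>G\<^esub> v\<close> says that \<open>uv\<close> is an edge.
\<close>

definition components :: "('a, 'b) pre_digraph \<Rightarrow> ('a, 'b) pre_digraph set" where
  "components G = {C. pre_digraph.max_subgraph G connected C}"

datatype 'a rtree = Node 'a "'a rtree fset"

inductive elimination_tree :: "('a, 'b) pre_digraph \<Rightarrow> 'a rtree \<Rightarrow> bool" where
  "\<lbrakk> connected G; r \<in> verts G;
     bij_betw sub (components (pre_digraph.del_vert G r)) (fset ts);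
     \<forall>C \<in> components (pre_digraph.del_vert G r). elimination_tree C (sub C) \<rbrakk>
   \<Longrightarrow> elimination_tree G (Node r ts)"

inductive root_to_leaf_path :: "'a rtree \<Rightarrow> 'a list \<Rightarrow> bool" where
  leaf: "root_to_leaf_path (Node v {||}) [v]"
| step: "\<lbrakk> t |\<in>| ts; root_to_leaf_path t p \<rbrakk> \<Longrightarrow> root_to_leaf_path (Node v ts) (v # p)"

lemma ex_root_to_leaf_path: "\<exists>p. root_to_leaf_path t p"
proof (induction t)
  case (Node v ts)
  then show ?case
    by (cases "ts = {||}") (auto intro: root_to_leaf_path.intros)
qed

lemma finite_root_to_leaf_paths: "finite {p. root_to_leaf_path t p}"
proof (induction t)
  case (Node v ts)
  have "{p. root_to_leaf_path (Node v ts) p}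
      \<subseteq> insert [v] (\<Union>t \<in> fset ts. (#) v ` {p. root_to_leaf_path t p})"
    by (auto elim!: root_to_leaf_path.cases[of "Node v ts"])
  moreover have "finite (insert [v] (\<Union>t \<in> fset ts. (#) v ` {p. root_to_leaf_path t p}))"
    using Node by auto
  ultimately show ?case
    by (rule finite_subset)
qed

definition depth :: "'a rtree \<Rightarrow> nat" where
  "depth t = Max (length ` {p. root_to_leaf_path t p})"

definition edge_block :: "('a, 'b) pre_digraph \<Rightarrow> 'a list \<Rightarrow> bool" where
  "edge_block G b \<longleftrightarrow> (\<exists>u v. b = [u, v] \<and> u \<rightarrow>\<^bsub>G\<^esub> v)"

definition triple_block :: "('a, 'b) pre_digraph \<Rightarrow> 'a list \<Rightarrow> bool" where
  "triple_block G b \<longleftrightarrow> (\<exists>u v w. b = [u, v, w] \<and> u \<rightarrow>\<^bsub>G\<^esub> v \<and> v \<rightarrow>\<^bsub>G\<^esub> w)"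

text \<open>
  The even case asks for the edges \<open>v\<^sub>1v\<^sub>2, v\<^sub>3v\<^sub>4, \<dots>\<close>, list positions being counted from 0.
  In the odd case \<open>bs @ b # cs\<close> is the sequence of blocks, and \<open>b\<close> the one of size 3.
\<close>

definition matched_path :: "('a, 'b) pre_digraph \<Rightarrow> 'a list \<Rightarrow> bool" where
  "matched_path G p \<longleftrightarrow>
    (if even (length p)
     then \<forall>i < length p div 2. p ! (2 * i) \<rightarrow>\<^bsub>G\<^esub> p ! (2 * i + 1)
     else \<exists>bs b cs. p = concat (bs @ b # cs) \<and> triple_block G b \<and>
            (\<forall>c \<in> set bs \<union> set cs. edge_block G c))"

definition matched_elimination_tree :: "('a, 'b) pre_digraph \<Rightarrow> 'a rtree \<Rightarrow> bool" where
  "matched_elimination_tree G t \<longleftrightarrow>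
    elimination_tree G t \<and> (\<forall>p. root_to_leaf_path t p \<longrightarrow> matched_path G p)"

text \<open>
  The minima are taken in \<^typ>\<open>enat\<close>, so that the parameter is \<open>\<infinity>\<close> if there is no such tree
  (a one-vertex graph has no matched elimination tree).
\<close>

definition td :: "('a, 'b) pre_digraph \<Rightarrow> enat" where
  "td G = (INF t \<in> {t. elimination_tree G t}. enat (depth t))"

definition mtd :: "('a, 'b) pre_digraph \<Rightarrow> enat" where
  "mtd G = (INF t \<in> {t. matched_elimination_tree G t}. enat (depth t))"

definition simple_graph :: "nat set \<Rightarrow> (nat \<times> nat) set \<Rightarrow> (nat, nat \<times> nat) pre_digraph" where
  "simple_graph V E = with_proj \<lparr> pverts = V, parcs = E \<union> E\<inverse> \<rparr>"

definition C4 :: "(nat, nat \<times> nat) pre_digraph" where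
  "C4 = simple_graph {0..<4} {(0, 1), (1, 2), (2, 3), (3, 0)}"

definition P6 :: "(nat, nat \<times> nat) pre_digraph" where
  "P6 = simple_graph {0..<6} {(0, 1), (1, 2), (2, 3), (3, 4), (4, 5)}"

text \<open>The triangle is \<open>0, 1, 2\<close> and the pendant path \<open>0, 3, 4, 5\<close>.\<close>

definition T33 :: "(nat, nat \<times> nat) pre_digraph" where
  "T33 = simple_graph {0..<6} {(0, 1), (1, 2), (2, 0), (0, 3), (3, 4), (4, 5)}"

definition contains_induced :: "('a, 'b) pre_digraph \<Rightarrow> ('c, 'd) pre_digraph \<Rightarrow> bool" where
  "contains_induced G F \<longleftrightarrow> (\<exists>H. induced_subgraph H G \<and> digraph_iso H F)"

end

theory Submission
  imports Defs
begin

text \<open>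
  A matched elimination tree of depth at most 3 with root \<open>r\<close> exists iff every component of \<open>G - r\<close>
  is a star with a centre adjacent to \<open>r\<close>; without matching, the centre need not be adjacent to \<open>r\<close>.
  No choice of \<open>r\<close> makes this possible for \<open>C\<^sub>4\<close>, \<open>P\<^sub>6\<close> or \<open>T\<^sub>3\<^sub>,\<^sub>3\<close>, inside or outside of the
  forbidden subgraph.
  Conversely, take the root \<open>r\<close> of an elimination tree of depth 3 and suppose that a component \<open>C\<close>
  has no centre adjacent to \<open>r\<close>. It is a star with centre \<open>c\<close> and at least two leaves, and exactly
  one leaf \<open>l\<close> is adjacent to \<open>r\<close>, as there is no induced \<open>C\<^sub>4\<close>. With another leaf \<open>l'\<close> the path
  \<open>r - l - c - l'\<close> is induced, and an edge inside any other component would extend it to an induced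
  \<open>P\<^sub>6\<close> or \<open>T\<^sub>3\<^sub>,\<^sub>3\<close>. Hence all other components are leaves at \<open>r\<close>, and \<open>G - l\<close> consists of the star
  at \<open>r\<close>, the star at \<open>c\<close>, and nothing else, so \<open>l\<close> is a suitable root.
\<close>

subsection \<open>Components of graphs\<close>

lemma (in sym_digraph) dominates_sym: "u \<rightarrow> v \<longleftrightarrow> v \<rightarrow> u"
  using sym_arcs by (auto simp: symmetric_def dest: symD)

lemma (in loopfree_digraph) not_dominates_self: "\<not> u \<rightarrow> u"
  using adj_not_same by blast

lemma dominates_del_vert_iff:
  "u \<rightarrow>\<^bsub>pre_digraph.del_vert G r\<^esub> v \<longleftrightarrow> u \<rightarrow>\<^bsub>G\<^esub> v \<and> u \<noteq> r \<and> v \<noteq> r"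
  by (auto simp: arcs_ends_def arc_to_ends_def pre_digraph.del_vert_simps)

lemma dominates_induce_subgraph_iff:
  "u \<rightarrow>\<^bsub>G \<restriction> S\<^esub> v \<longleftrightarrow> u \<rightarrow>\<^bsub>G\<^esub> v \<and> u \<in> S \<and> v \<in> S"
  by (auto simp: arcs_ends_def arc_to_ends_def)

lemma graph_induce_subgraph:
  assumes "graph G" "S \<subseteq> verts G"
  shows "graph (G \<restriction> S)"
proof -
  interpret graph G by fact
  have ind: "induced_subgraph (G \<restriction> S) G"
    using assms(2) by blast
  interpret S: sym_digraph "G \<restriction> S"
    using ind by (rule induced_graph_imp_graph)
  show ?thesis
    using assms(2) no_loops no_multi_arcs
    by unfold_locales (auto simp: finite_subset)
qed

lemma del_vert_eq_induce_subgraph: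
  assumes "wf_digraph G"
  shows "pre_digraph.del_vert G r = G \<restriction> (verts G - {r})"
  using assms by (auto simp: pre_digraph.del_vert_def induce_subgraph_def wf_digraph_def)

lemma graph_del_vert:
  assumes "graph G"
  shows "graph (pre_digraph.del_vert G r)"
proof -
  interpret graph G by fact
  show ?thesis
    using assms by (simp add: del_vert_eq_induce_subgraph wf_digraph_axioms graph_induce_subgraph)
qed

lemma (in wf_digraph) strongly_connected_imp_connected: "strongly_connected G \<Longrightarrow> connected G"
  by (auto simp: connected_def strongly_connected_def reachable_mk_symmetricI)

context sym_digraph
begin

lemma connected_eq_strongly_connected: "connected G \<longleftrightarrow> strongly_connected G"
  using symmetric_connected_imp_strongly_connected strongly_connected_imp_connected by blast

text \<open>Adding arcs on a fixed vertex set keeps a graph connected. This forces a maximal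
  connected subgraph to be induced, and hence symmetric.\<close>

lemma arc_mono_connected: "arc_mono connected"
  unfolding arc_mono_def
  by (metis spanning_def subgraphE wf_digraph.connected_spanning_imp_connected)

text \<open>Connectivity and strong connectivity agree for symmetric digraphs, but a subgraph need
  not be symmetric; both inclusions therefore go through induced subgraphs. The gain is the
  description of \<open>sccs\<close> by reachability.\<close>

lemma components_eq_sccs: "components G = sccs"
proof -
  have "H \<in> sccs" if "max_subgraph connected H" for H
  proof -
    have "induced_subgraph H G"
      using that arc_mono_connected by (rule induced_subgraphI_arc_mono)
    then interpret H: sym_digraph H
      by (rule induced_graph_imp_graph)
    have "strongly_connected H"
      using max_subgraph_prop[OF that] H.connected_eq_strongly_connected by blast
    then show ?thesis
      using that
      by (auto simp: sccs_altdef2 max_subgraph_def subgraph_def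
          intro: wf_digraph.strongly_connected_imp_connected)
  qed
  moreover have "max_subgraph connected H" if "H \<in> sccs" for H
  proof -
    have ind: "subgraph H G" "connected H"
      using that wf_digraph.strongly_connected_imp_connected
      by (auto simp: sccs_def dest: wf_digraphI_induced)
    have "\<not> connected H'" if H': "H' \<noteq> H" "subgraph H H'" "subgraph H' G" for H'
    proof
      assume con: "connected H'"
      \<comment> \<open>\<open>H'\<close> may lack the reverses of its arcs. The induced subgraph on
        its vertices is symmetric, and it is strongly connected because \<open>H'\<close> spans
        it.\<close>
      let ?K = "G \<restriction> verts H'"
      have sub: "verts H' \<subseteq> verts G" using H' by auto
      then have iK: "induced_subgraph ?K G" by blast
      then interpret K: sym_digraph ?K by (rule induced_graph_imp_graph)
      have "spanning H' ?K"
        using H' by (auto simp: spanning_def subgraph_induce_subgraphI2)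
      then have "strongly_connected ?K"
        using con K.connected_spanning_imp_connected K.connected_eq_strongly_connected by blast
      moreover have "verts H \<subseteq> verts H'" using H' by auto
      ultimately have "verts H = verts H'"
        using \<open>H \<in> sccs\<close> iK unfolding sccs_def
        by (metis (no_types, lifting) induce_subgraph_verts mem_Collect_eq psubsetI)
      moreover have "arcs H' \<subseteq> arcs H"
      proof
        fix e assume e: "e \<in> arcs H'"
        interpret H': wf_digraph H' using H' by auto
        have "e \<in> arcs G" "tail G e \<in> verts H'" "head G e \<in> verts H'"
          using e H'(3) H'.tail_in_verts[OF e] H'.head_in_verts[OF e]
          by (auto simp: subgraph_def compatible_def)
        then show "e \<in> arcs H"
          using \<open>H \<in> sccs\<close> \<open>verts H = verts H'\<close> by (simp add: sccs_def induced_subgraph_def)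
      qed
      ultimately have "H = H'"
        using H'(2) by (intro pre_digraph.equality) (auto simp: subgraph_def compatible_def)
      then show False using H' by simp
    qed
    then show ?thesis
      using ind by (auto simp: max_subgraph_def)
  qed
  ultimately show ?thesis
    by (auto simp: components_def)
qed

text \<open>Reachability is symmetric, so the mutual reachability behind \<open>scc_of\<close>
  collapses to reachability. The image form gives access to finiteness, covering and disjointness of
  components.\<close>

lemma components_eq_reachable: "components G = (\<lambda>u. G \<restriction> {v. u \<rightarrow>\<^sup>* v}) ` verts G"
proof -
  have "scc_of u = {v. u \<rightarrow>\<^sup>* v}" for u
    using symmetric_reachable[OF sym_arcs] by (auto simp: scc_of_def)
  then show ?thesis
    by (simp add: components_eq_sccs sccs_conv_sccs_verts sccs_verts_conv_scc_of image_image)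
qed

end


text \<open>Induction along a walk from \<open>u\<close>. With \<open>P\<close> a membership it says
  that a nonempty vertex set closed under adjacency contains every vertex.\<close>

lemma connected_induct:
  assumes "graph G" "connected G" "v \<in> verts G" "u \<in> verts G" "P u"
    and step: "\<And>x y. x \<rightarrow>\<^bsub>G\<^esub> y \<Longrightarrow> P x \<Longrightarrow> P y"
  shows "P v"
proof -
  interpret graph G by fact
  have "u \<rightarrow>\<^sup>*\<^bsub>G\<^esub> v"
    using assms connected_eq_strongly_connected by (auto simp: strongly_connected_def)
  then show ?thesis
    by (induction rule: reachable_induct) (use assms in auto)
qed

section \<open>Components left by the deletion of a vertex\<close>

lemma components_empty:
  assumes "graph G" "verts G = {}"
  shows "components G = {}"
proof -
  interpret graph G by fact
  show ?thesis using assms by (simp add: components_eq_reachable)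
qed

locale deleted_vertex = graph G for G :: "('a, 'b) pre_digraph" (structure) +
  fixes r :: 'a
begin

abbreviation "comps \<equiv> components (del_vert r)"

sublocale D: graph "del_vert r"
  using graph_axioms by (rule graph_del_vert)

lemma reachable_del_vert_verts: "{v. u \<rightarrow>\<^sup>*\<^bsub>del_vert r\<^esub> v} \<subseteq> verts G - {r}"
  using D.reachable_in_verts(2) by (auto simp: del_vert_simps)

lemma reachable_del_vert_refl: "u \<in> verts G \<Longrightarrow> u \<noteq> r \<Longrightarrow> u \<rightarrow>\<^sup>*\<^bsub>del_vert r\<^esub> u"
  by (simp add: D.reachable_refl del_vert_simps)

text \<open>Restricting \<open>G\<close> instead of \<open>del_vert r\<close> lets adjacency in a
  component be compared directly with adjacency in \<open>G\<close>.\<close>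

lemma comps_eq: "comps = (\<lambda>u. G \<restriction> {v. u \<rightarrow>\<^sup>*\<^bsub>del_vert r\<^esub> v}) ` (verts G - {r})"
proof -
  have "del_vert r \<restriction> S = G \<restriction> S" if "S \<subseteq> verts G - {r}" for S
    using that by (auto simp: del_vert_eq_induce_subgraph wf_digraph_axioms induce_subgraph_def)
  then show ?thesis
    unfolding D.components_eq_reachable using reachable_del_vert_verts
    by (auto simp: del_vert_simps intro!: image_cong)
qed

lemma finite_comps: "finite comps"
  by (simp add: comps_eq)

lemma comp_verts: "C \<in> comps \<Longrightarrow> verts C \<subseteq> verts G - {r}"
  by (auto simp: comps_eq dest: subsetD[OF reachable_del_vert_verts, OF CollectI])

lemma comp_not_empty: "C \<in> comps \<Longrightarrow> verts C \<noteq> {}"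
  using reachable_del_vert_refl by (fastforce simp: comps_eq)

lemma comp_dominates_iff:
  "C \<in> comps \<Longrightarrow> u \<rightarrow>\<^bsub>C\<^esub> v \<longleftrightarrow> u \<rightarrow> v \<and> u \<in> verts C \<and> v \<in> verts C"
  by (auto simp: comps_eq dominates_induce_subgraph_iff)

lemma comp_closed:
  assumes "C \<in> comps" "u \<in> verts C" "u \<rightarrow> v" "v \<noteq> r"
  shows "v \<in> verts C"
proof -
  have "u \<rightarrow>\<^bsub>del_vert r\<^esub> v"
    using assms comp_verts by (auto simp: dominates_del_vert_iff)
  then show ?thesis
    using assms by (auto simp: comps_eq intro: D.reachable_adj_trans)
qed

lemma comp_connected: "C \<in> comps \<Longrightarrow> connected C"
  by (auto simp: components_def pre_digraph.max_subgraph_def)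

lemma comp_graph: "C \<in> comps \<Longrightarrow> graph C"
  using comp_verts[of C] by (auto simp: comps_eq intro!: graph_induce_subgraph graph_axioms)

lemma comp_exists: "v \<in> verts G \<Longrightarrow> v \<noteq> r \<Longrightarrow> \<exists>C\<in>comps. v \<in> verts C"
  using reachable_del_vert_refl by (fastforce simp: comps_eq)

text \<open>By symmetry and transitivity, a component is the reachable set of each of its
  vertices.\<close>

lemma comp_eq:
  assumes "C \<in> comps" "C' \<in> comps" "v \<in> verts C" "v \<in> verts C'"
  shows "C = C'"
proof -
  have "{w. u \<rightarrow>\<^sup>*\<^bsub>del_vert r\<^esub> w} = {w. v \<rightarrow>\<^sup>*\<^bsub>del_vert r\<^esub> w}"
    if "u \<rightarrow>\<^sup>*\<^bsub>del_vert r\<^esub> v" for u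
    using that D.symmetric_reachable' D.reachable_trans by blast
  then show ?thesis
    using assms by (auto simp: comps_eq)
qed

text \<open>Otherwise \<open>verts C\<close> would be closed under adjacency in all of
  \<open>G\<close>, and connectedness would put \<open>r\<close> into it.\<close>

lemma comp_root_neighbour:
  assumes "connected G" "r \<in> verts G" "C \<in> comps"
  shows "\<exists>v\<in>verts C. r \<rightarrow> v"
proof (rule ccontr)
  assume no: "\<not> ?thesis"
  obtain u where u: "u \<in> verts C"
    using comp_not_empty[OF assms(3)] by auto
  then have "u \<in> verts G"
    using comp_verts assms by blast
  have "r \<in> verts C"
  proof (rule connected_induct[OF graph_axioms assms(1,2) \<open>u \<in> verts G\<close>, of "\<lambda>x. x \<in> verts C"])
    fix x y assume xy: "x \<rightarrow> y" "x \<in> verts C"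
    then have "y \<rightarrow> x" using dominates_sym by blast
    then show "y \<in> verts C"
      using xy no comp_closed[OF assms(3)] by blast
  qed (rule u)
  then show False
    using comp_verts assms by blast
qed

end

subsection \<open>Elimination trees of depth at most 3\<close>

text \<open>For a connected graph this is a star with centre \<open>c\<close>, a single vertex
  included. That \<open>c\<close> is adjacent to all other vertices is left to
  connectedness.\<close>

definition star_center :: "('a, 'b) pre_digraph \<Rightarrow> 'a \<Rightarrow> bool" where
  "star_center G c \<longleftrightarrow> c \<in> verts G \<and> (\<forall>u v. u \<rightarrow>\<^bsub>G\<^esub> v \<longrightarrow> u = c \<or> v = c)"

text \<open>A walk from \<open>c\<close> goes to a neighbour of \<open>c\<close> and from there can
  only return to \<open>c\<close>.\<close>

lemma star_center_dominates:
  assumes "graph G" "connected G" "star_center G c" "v \<in> verts G" "v \<noteq> c"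
  shows "c \<rightarrow>\<^bsub>G\<^esub> v"
proof -
  have "c \<in> verts G" using assms by (simp add: star_center_def)
  then have "v = c \<or> c \<rightarrow>\<^bsub>G\<^esub> v"
    by (intro connected_induct[OF assms(1,2,4), of c "\<lambda>v. v = c \<or> c \<rightarrow>\<^bsub>G\<^esub> v"])
      (use assms(3) in \<open>auto simp: star_center_def\<close>)
  then show ?thesis using assms by simp
qed


section \<open>Root-to-leaf paths and depth\<close>

primrec root_vert :: "'a rtree \<Rightarrow> 'a" where
  "root_vert (Node v ts) = v"

lemma root_to_leaf_path_Node_iff:
  "root_to_leaf_path (Node v ts) p \<longleftrightarrow>
    ts = {||} \<and> p = [v] \<or> (\<exists>t q. t |\<in>| ts \<and> root_to_leaf_path t q \<and> p = v # q)"
  by (subst root_to_leaf_path.simps) auto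

lemma root_to_leaf_path_root: "root_to_leaf_path t p \<Longrightarrow> \<exists>q. p = root_vert t # q"
  by (cases t) (auto simp: root_to_leaf_path_Node_iff)

lemma depth_le_iff: "depth t \<le> n \<longleftrightarrow> (\<forall>p. root_to_leaf_path t p \<longrightarrow> length p \<le> n)"
  using finite_root_to_leaf_paths[of t] ex_root_to_leaf_path[of t]
  unfolding depth_def by (subst Max_le_iff) auto

lemma depth_subtree_le: "t |\<in>| ts \<Longrightarrow> depth (Node v ts) \<le> Suc n \<Longrightarrow> depth t \<le> n"
  unfolding depth_le_iff by (metis Suc_le_mono length_Cons root_to_leaf_path.step)

lemma depth_pos: "0 < depth t"
proof -
  have "\<not> depth t \<le> 0"
    unfolding depth_le_iff
    by (metis ex_root_to_leaf_path le_zero_eq length_0_conv list.distinct(1) root_to_leaf_path_root)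
  then show ?thesis by simp
qed

section \<open>Structure forced by a bound on the depth\<close>

lemma elimination_tree_root: "elimination_tree G t \<Longrightarrow> root_vert t \<in> verts G"
  by (auto elim: elimination_tree.cases)

lemma elimination_tree_subtree:
  assumes "elimination_tree G (Node r ts)" "C \<in> components (pre_digraph.del_vert G r)"
  shows "\<exists>t. t |\<in>| ts \<and> elimination_tree C t"
  using assms by (cases rule: elimination_tree.cases) (auto simp: bij_betw_def)

text \<open>Lets an edge that avoids the root be passed down to a subtree, where the depth bound is
  smaller by one.\<close>

lemma elimination_tree_component_of_edge:
  assumes "graph G" "elimination_tree G (Node r ts)" "u \<rightarrow>\<^bsub>G\<^esub> v" "u \<noteq> r" "v \<noteq> r"
  obtains C t where "C \<in> components (pre_digraph.del_vert G r)" "u \<rightarrow>\<^bsub>C\<^esub> v"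
    "t |\<in>| ts" "elimination_tree C t"
proof -
  interpret deleted_vertex G r
    using assms(1) by (simp add: deleted_vertex_def)
  obtain C where C: "C \<in> comps" "u \<in> verts C"
    using assms(3,4) comp_exists adj_in_verts by blast
  then have "u \<rightarrow>\<^bsub>C\<^esub> v"
    using comp_closed comp_dominates_iff assms(3,5) by blast
  then show ?thesis
    using that elimination_tree_subtree[OF assms(2)] C by blast
qed

text \<open>An edge has an end other than the root, hence there is a component below the root, and
  its subtree would have depth 0.\<close>

lemma elimination_tree_depth_le_1:
  assumes "graph G" "elimination_tree G t" "depth t \<le> 1"
  shows "\<not> u \<rightarrow>\<^bsub>G\<^esub> v"
proof
  assume uv: "u \<rightarrow>\<^bsub>G\<^esub> v"
  obtain r ts where t: "t = Node r ts" by (cases t)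
  interpret deleted_vertex G r
    using assms(1) by (simp add: deleted_vertex_def)
  have "u \<noteq> v"
    using uv adj_not_same by blast
  then obtain w where "w \<in> verts G" "w \<noteq> r"
    using uv adj_in_verts by metis
  then obtain C where "C \<in> comps"
    using comp_exists by blast
  then obtain t' where t': "t' |\<in>| ts"
    using elimination_tree_subtree[OF assms(2)[unfolded t]] by blast
  then have "depth t' \<le> 0"
    using assms(3) t depth_subtree_le[of t' ts r 0] by simp
  then show False using depth_pos[of t'] by simp
qed

text \<open>An edge avoiding the root would lie in a component with a tree of depth at most 1, and
  such a component has no edges.\<close>

lemma elimination_tree_depth_le_2:
  assumes "graph G" "elimination_tree G t" "depth t \<le> 2"
  shows "star_center G (root_vert t)"
proof -
  obtain r ts where t: "t = Node r ts" by (cases t)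
  interpret deleted_vertex G r
    using assms(1) by (simp add: deleted_vertex_def)
  have "u = r \<or> v = r" if uv: "u \<rightarrow>\<^bsub>G\<^esub> v" for u v
  proof (rule ccontr)
    assume "\<not> ?thesis"
    then obtain C t' where C: "C \<in> comps" "u \<rightarrow>\<^bsub>C\<^esub> v" "t' |\<in>| ts" "elimination_tree C t'"
      using elimination_tree_component_of_edge[OF assms(1) assms(2)[unfolded t] uv] by metis
    moreover have "depth t' \<le> 1"
      using assms(3) t C(3) depth_subtree_le[of t' ts r 1] by simp
    ultimately show False
      using elimination_tree_depth_le_1[OF comp_graph] by metis
  qed
  then show ?thesis
    using elimination_tree_root[OF assms(2)] t by (simp add: star_center_def)
qed

text \<open>The centre is given as the root of a subtree in \<open>ts\<close>, so that the matching
  condition can later be applied to this same vertex.\<close>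

lemma elimination_tree_depth_le_3:
  assumes "graph G" "elimination_tree G (Node r ts)" "depth (Node r ts) \<le> 3"
    and "C \<in> components (pre_digraph.del_vert G r)"
  shows "\<exists>t. t |\<in>| ts \<and> star_center C (root_vert t)"
proof -
  interpret deleted_vertex G r
    using assms(1) by (simp add: deleted_vertex_def)
  obtain t where "t |\<in>| ts" "elimination_tree C t"
    using elimination_tree_subtree[OF assms(2,4)] by blast
  moreover have "depth t \<le> 2"
    using assms(3) \<open>t |\<in>| ts\<close> depth_subtree_le[of t ts r 2] by simp
  ultimately show ?thesis
    using elimination_tree_depth_le_2[OF comp_graph[OF assms(4)]] by metis
qed

section \<open>Matched paths with two or three vertices\<close>

lemma matched_path_pair_iff: "matched_path G [u, v] \<longleftrightarrow> u \<rightarrow>\<^bsub>G\<^esub> v"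
  by (simp add: matched_path_def)

lemma matched_path_triple_iff: "matched_path G [u, v, w] \<longleftrightarrow> u \<rightarrow>\<^bsub>G\<^esub> v \<and> v \<rightarrow>\<^bsub>G\<^esub> w"
proof
  assume "matched_path G [u, v, w]"
  then obtain bs b cs where p: "[u, v, w] = concat (bs @ b # cs)" and b: "triple_block G b"
    by (auto simp: matched_path_def)
  \<comment> \<open>The block of size 3 already uses up the whole length, so nothing is left for the
    other blocks.\<close>
  have "length [u, v, w] = length (concat bs) + length b + length (concat cs)"
    unfolding p by simp
  moreover have "length b = 3"
    using b by (auto simp: triple_block_def)
  ultimately have "concat bs = []" "concat cs = []"
    by simp_all
  then have "[u, v, w] = b"
    using p by (simp only: concat_append concat.simps(2) append_Nil append_Nil2)
  then show "u \<rightarrow>\<^bsub>G\<^esub> v \<and> v \<rightarrow>\<^bsub>G\<^esub> w"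
    using b by (auto simp: triple_block_def)
next
  assume uvw: "u \<rightarrow>\<^bsub>G\<^esub> v \<and> v \<rightarrow>\<^bsub>G\<^esub> w"
  have "odd (length [u, v, w])" by simp
  moreover have "[u, v, w] = concat ([] @ [u, v, w] # []) \<and> triple_block G [u, v, w] \<and>
      (\<forall>c \<in> set [] \<union> set []. edge_block G c)"
    using uvw by (simp add: triple_block_def)
  ultimately show "matched_path G [u, v, w]"
    unfolding matched_path_def by (metis (no_types))
qed

text \<open>A path through \<open>t\<close> has two or three vertices, thus consists of a single
  block, which begins with the edge from \<open>r\<close> to the root of \<open>t\<close>.\<close>

lemma matched_elimination_tree_root_dominates:
  assumes "matched_elimination_tree G (Node r ts)" "depth (Node r ts) \<le> 3" "t |\<in>| ts"
  shows "r \<rightarrow>\<^bsub>G\<^esub> root_vert t"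
proof -
  obtain p where p: "root_to_leaf_path t p"
    using ex_root_to_leaf_path by blast
  then obtain q where q: "p = root_vert t # q"
    using root_to_leaf_path_root by blast
  have path: "root_to_leaf_path (Node r ts) (r # root_vert t # q)"
    using p q assms(3) by (auto simp: root_to_leaf_path_Node_iff)
  then have "length (r # root_vert t # q) \<le> 3"
    using assms(2) unfolding depth_le_iff by blast
  then consider "q = []" | l where "q = [l]"
    by (cases q) auto
  then show ?thesis
    using path assms(1)
    by cases (auto simp: matched_elimination_tree_def matched_path_pair_iff matched_path_triple_iff)
qed

section \<open>Construction of elimination trees\<close>

lemma elimination_treeI:
  assumes "graph G" "connected G" "r \<in> verts G"
    and sub: "\<And>C. C \<in> components (pre_digraph.del_vert G r) \<Longrightarrow> elimination_tree C (sub C)"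
  shows "elimination_tree G (Node r (Abs_fset (sub ` components (pre_digraph.del_vert G r))))"
proof -
  interpret deleted_vertex G r
    using assms(1) by (simp add: deleted_vertex_def)
  \<comment> \<open>The root of \<open>sub C\<close> lies in \<open>C\<close>, and distinct
    components are disjoint.\<close>
  have "inj_on sub comps"
    by (rule inj_onI) (metis comp_eq elimination_tree_root sub)
  then have "bij_betw sub comps (fset (Abs_fset (sub ` comps)))"
    using finite_comps by (simp add: bij_betw_def Abs_fset_inverse)
  then show ?thesis
    using assms by (auto intro: elimination_tree.intros)
qed

lemma singleton_elimination_tree:
  assumes "graph G" "connected G" "verts G = {v}"
  shows "elimination_tree G (Node v {||})"
proof -
  have "components (pre_digraph.del_vert G v) = {}"
    using assms by (simp add: components_empty graph_del_vert pre_digraph.del_vert_simps)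
  then show ?thesis
    using assms by (auto intro!: elimination_tree.intros simp: bij_betw_def)
qed

text \<open>Without the centre no edge remains, so every component is a single vertex, and it is
  adjacent to \<open>c\<close>. The second conjunct records these edges for the matching.\<close>

lemma star_elimination_tree:
  assumes "graph G" "connected G" "star_center G c"
  shows "\<exists>ts. elimination_tree G (Node c ts) \<and>
    (\<forall>t. t |\<in>| ts \<longrightarrow> (\<exists>l. t = Node l {||} \<and> c \<rightarrow>\<^bsub>G\<^esub> l))"
proof -
  interpret deleted_vertex G c
    using assms(1) by (simp add: deleted_vertex_def)
  have "\<exists>t. elimination_tree C t \<and> (\<exists>l. t = Node l {||} \<and> c \<rightarrow>\<^bsub>G\<^esub> l)" if C: "C \<in> comps" for C
  proof -
    obtain l where l: "l \<in> verts C"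
      using comp_not_empty C by blast
    have "\<not> u \<rightarrow>\<^bsub>C\<^esub> v" for u v
      using comp_dominates_iff[OF C] comp_verts[OF C] assms(3) unfolding star_center_def by blast
    \<comment> \<open>\<open>C\<close> has no edges, so the induction step is vacuous.\<close>
    then have "v = l" if "v \<in> verts C" for v
      using connected_induct[OF comp_graph[OF C] comp_connected[OF C] that l, of "\<lambda>v. v = l"] by blast
    then have "verts C = {l}"
      using l by blast
    then have "elimination_tree C (Node l {||})"
      by (rule singleton_elimination_tree[OF comp_graph[OF C] comp_connected[OF C]])
    moreover have "c \<rightarrow>\<^bsub>G\<^esub> l"
      using star_center_dominates[OF assms] l comp_verts[OF C] by blast
    ultimately show ?thesis by blast
  qed
  then obtain sub where sub: "\<And>C. C \<in> comps \<Longrightarrow>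
      elimination_tree C (sub C) \<and> (\<exists>l. sub C = Node l {||} \<and> c \<rightarrow>\<^bsub>G\<^esub> l)"
    by metis
  then have "elimination_tree G (Node c (Abs_fset (sub ` comps)))"
    using assms by (intro elimination_treeI) (auto simp: star_center_def)
  moreover have "\<forall>t. t |\<in>| Abs_fset (sub ` comps) \<longrightarrow> (\<exists>l. t = Node l {||} \<and> c \<rightarrow>\<^bsub>G\<^esub> l)"
    using sub finite_comps by (auto simp: Abs_fset_inverse)
  ultimately show ?thesis by blast
qed

text \<open>With the centres as children of \<open>r\<close>, every path is \<open>[r, c]\<close> or
  \<open>[r, c, l]\<close>, and its consecutive vertices are adjacent.\<close>

lemma matched_elimination_tree_of_star_components:
  assumes "graph G" "connected G" "r \<in> verts G" "verts G \<noteq> {r}"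
    and star: "\<And>C. C \<in> components (pre_digraph.del_vert G r) \<Longrightarrow>
      \<exists>c. star_center C c \<and> r \<rightarrow>\<^bsub>G\<^esub> c"
  shows "\<exists>t. matched_elimination_tree G t \<and> depth t \<le> 3"
proof -
  interpret deleted_vertex G r
    using assms(1) by (simp add: deleted_vertex_def)
  have "\<exists>t. elimination_tree C t \<and> (\<exists>c ts. t = Node c ts \<and> r \<rightarrow>\<^bsub>G\<^esub> c \<and>
      (\<forall>t'. t' |\<in>| ts \<longrightarrow> (\<exists>l. t' = Node l {||} \<and> c \<rightarrow>\<^bsub>G\<^esub> l)))" if C: "C \<in> comps" for C
  proof -
    obtain c where c: "star_center C c" "r \<rightarrow>\<^bsub>G\<^esub> c"
      using star C by blast
    obtain ts where ts: "elimination_tree C (Node c ts)"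
      "\<forall>t. t |\<in>| ts \<longrightarrow> (\<exists>l. t = Node l {||} \<and> c \<rightarrow>\<^bsub>C\<^esub> l)"
      using star_elimination_tree[OF comp_graph[OF C] comp_connected[OF C] c(1)] by metis
    from ts(2) have "\<forall>t. t |\<in>| ts \<longrightarrow> (\<exists>l. t = Node l {||} \<and> c \<rightarrow>\<^bsub>G\<^esub> l)"
      unfolding comp_dominates_iff[OF C] by metis
    then show ?thesis
      using ts(1) c(2) by metis
  qed
  then obtain sub where sub: "\<And>C. C \<in> comps \<Longrightarrow>
      elimination_tree C (sub C) \<and> (\<exists>c ts. sub C = Node c ts \<and> r \<rightarrow>\<^bsub>G\<^esub> c \<and>
        (\<forall>t'. t' |\<in>| ts \<longrightarrow> (\<exists>l. t' = Node l {||} \<and> c \<rightarrow>\<^bsub>G\<^esub> l)))"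
    by metis
  define ts where "ts = Abs_fset (sub ` comps)"
  have ts: "fset ts = sub ` comps"
    using finite_comps by (simp add: ts_def Abs_fset_inverse)
  have tree: "elimination_tree G (Node r ts)"
    unfolding ts_def using assms(1-3) sub by (intro elimination_treeI) auto
  \<comment> \<open>This excludes the path \<open>[r]\<close>, which is not matched: its length is
    odd and it has no room for a block of size 3.\<close>
  have "comps \<noteq> {}"
    using comp_exists assms(3,4) by blast
  then have "ts \<noteq> {||}"
    using ts by auto
  have "matched_path G p \<and> length p \<le> 3" if p: "root_to_leaf_path (Node r ts) p" for p
  proof -
    obtain C q where C: "C \<in> comps" "root_to_leaf_path (sub C) q" "p = r # q"
      using p \<open>ts \<noteq> {||}\<close> ts by (auto simp: root_to_leaf_path_Node_iff)
    then obtain c ts' where c: "r \<rightarrow>\<^bsub>G\<^esub> c" "root_to_leaf_path (Node c ts') q"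
      and l: "\<forall>t'. t' |\<in>| ts' \<longrightarrow> (\<exists>l. t' = Node l {||} \<and> c \<rightarrow>\<^bsub>G\<^esub> l)"
      using sub[OF C(1)] by metis
    have "q = [c] \<or> (\<exists>l. q = [c, l] \<and> c \<rightarrow>\<^bsub>G\<^esub> l)"
    proof (cases "ts' = {||}")
      case True
      then show ?thesis using c(2) by (simp add: root_to_leaf_path_Node_iff)
    next
      case False
      then obtain t' q' where t': "t' |\<in>| ts'" "root_to_leaf_path t' q'" "q = c # q'"
        using c(2) by (auto simp: root_to_leaf_path_Node_iff)
      moreover obtain l where "t' = Node l {||}" "c \<rightarrow>\<^bsub>G\<^esub> l"
        using l t'(1) by blast
      ultimately show ?thesis
        by (simp add: root_to_leaf_path_Node_iff)
    qed
    then show ?thesis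
      using C(3) c(1) by (auto simp: matched_path_pair_iff matched_path_triple_iff)
  qed
  then show ?thesis
    using tree unfolding matched_elimination_tree_def depth_le_iff by blast
qed

subsection \<open>Induced subgraphs\<close>

lemma contains_induced_simple_graph_iff:
  assumes "graph G" "E \<subseteq> V \<times> V"
  shows "contains_induced G (simple_graph V E) \<longleftrightarrow>
    (\<exists>f. inj_on f V \<and> f ` V \<subseteq> verts G \<and>
      (\<forall>i\<in>V. \<forall>j\<in>V. f i \<rightarrow>\<^bsub>G\<^esub> f j \<longleftrightarrow> (i, j) \<in> E \<or> (j, i) \<in> E))"
proof
  interpret graph G by fact
  assume "contains_induced G (simple_graph V E)"
  then obtain H hom where H: "induced_subgraph H G"
    and hom: "pre_digraph.digraph_isomorphism H hom" and eq: "simple_graph V E = app_iso hom H"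
    by (auto simp: contains_induced_def digraph_iso_def)
  \<comment> \<open>Comparing the fields of both digraphs shows that the arcs of the image are pairs
    of ends, so \<open>hom\<close> must send an arc to the pair of images of its ends.\<close>
  have V: "V = iso_verts hom ` verts H" and E: "E \<union> E\<inverse> = iso_arcs hom ` arcs H"
    and ends: "iso_tail hom = fst" "iso_head hom = snd"
    using arg_cong[OF eq, of verts] arg_cong[OF eq, of arcs]
      arg_cong[OF eq, of tail] arg_cong[OF eq, of head]
    by (simp_all add: simple_graph_def with_proj_def)
  have inj: "inj_on (iso_verts hom) (verts H)"
    and arc: "\<And>a. a \<in> arcs H \<Longrightarrow>
      iso_arcs hom a = (iso_verts hom (tail H a), iso_verts hom (head H a))"
    using hom by (auto simp: pre_digraph.digraph_isomorphism_def ends)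
  have Hv: "verts H \<subseteq> verts G" and wfH: "wf_digraph H"
    using H by (auto simp: induced_subgraph_def subgraph_def)
  define f where "f = the_inv_into (verts H) (iso_verts hom)"
  have f: "f i \<in> verts H" "iso_verts hom (f i) = i" if "i \<in> V" for i
    using that inj unfolding f_def V
    by (auto simp: the_inv_into_f_f)
  have f_iso: "f (iso_verts hom x) = x" if "x \<in> verts H" for x
    using that inj by (simp add: f_def the_inv_into_f_f)
  have "f i \<rightarrow>\<^bsub>G\<^esub> f j \<longleftrightarrow> (i, j) \<in> E \<union> E\<inverse>" if ij: "i \<in> V" "j \<in> V" for i j
  proof
    assume "f i \<rightarrow>\<^bsub>G\<^esub> f j"
    then obtain e where e: "e \<in> arcs G" "tail G e = f i" "head G e = f j"
      by auto
    then have "e \<in> arcs H" "tail H e = f i" "head H e = f j"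
      using H f(1)[OF ij(1)] f(1)[OF ij(2)]
      by (auto simp: induced_subgraph_def subgraph_def compatible_def)
    then show "(i, j) \<in> E \<union> E\<inverse>"
      unfolding E using arc[of e] f ij by (auto intro!: rev_image_eqI[of e])
  next
    assume "(i, j) \<in> E \<union> E\<inverse>"
    then obtain e where e: "e \<in> arcs H" "iso_arcs hom e = (i, j)"
      unfolding E by force
    then have "f i = tail H e" "f j = head H e"
      using arc[of e] f_iso wfH by (auto simp: wf_digraph_def)
    then show "f i \<rightarrow>\<^bsub>G\<^esub> f j"
      using e(1) H
      by (auto simp: arcs_ends_def arc_to_ends_def induced_subgraph_def subgraph_def compatible_def)
  qed
  moreover have "inj_on f V" "f ` V \<subseteq> verts G"
    using f Hv by (auto intro: inj_on_inverseI)
  ultimately show "\<exists>f. inj_on f V \<and> f ` V \<subseteq> verts G \<and>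
      (\<forall>i\<in>V. \<forall>j\<in>V. f i \<rightarrow>\<^bsub>G\<^esub> f j \<longleftrightarrow> (i, j) \<in> E \<or> (j, i) \<in> E)"
    by (intro exI[of _ f]) auto
next
  interpret graph G by fact
  assume "\<exists>f. inj_on f V \<and> f ` V \<subseteq> verts G \<and>
      (\<forall>i\<in>V. \<forall>j\<in>V. f i \<rightarrow>\<^bsub>G\<^esub> f j \<longleftrightarrow> (i, j) \<in> E \<or> (j, i) \<in> E)"
  then obtain f where inj: "inj_on f V" and sub: "f ` V \<subseteq> verts G"
    and edge: "\<And>i j. i \<in> V \<Longrightarrow> j \<in> V \<Longrightarrow> f i \<rightarrow>\<^bsub>G\<^esub> f j \<longleftrightarrow> (i, j) \<in> E \<or> (j, i) \<in> E"
    by auto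
  define g where "g = the_inv_into V f"
  define H where "H = G \<restriction> (f ` V)"
  define hom :: "('a, 'b, nat, nat \<times> nat) digraph_isomorphism" where
    "hom = \<lparr> iso_verts = g, iso_arcs = \<lambda>a. (g (tail G a), g (head G a)),
      iso_head = snd, iso_tail = fst \<rparr>"
  have g: "g (f i) = i" if "i \<in> V" for i
    using that inj by (simp add: g_def the_inv_into_f_f)
  have inj_g: "inj_on g (f ` V)"
    by (auto intro!: inj_onI simp: g)
  have H: "induced_subgraph H G"
    unfolding H_def using sub by (rule induced_induce)
  \<comment> \<open>An arc is determined by its ends because there are no parallel arcs.\<close>
  have "inj_on (\<lambda>a. (g (tail G a), g (head G a))) (arcs H)"
  proof (rule inj_onI)
    fix a b
    assume ab: "a \<in> arcs H" "b \<in> arcs H" "(g (tail G a), g (head G a)) = (g (tail G b), g (head G b))"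
    then have "tail G a = tail G b" "head G a = head G b"
      using inj_g by (auto simp: H_def dest: inj_onD)
    then show "a = b"
      using ab no_multi_arcs by (auto simp: H_def arc_to_ends_def)
  qed
  then have "pre_digraph.digraph_isomorphism H hom"
    using wf_digraphI_induced[OF H] inj_g
    by (simp add: pre_digraph.digraph_isomorphism_def hom_def) (simp add: H_def)
  moreover have "simple_graph V E = app_iso hom H"
  proof -
    have "E \<union> E\<inverse> = (\<lambda>a. (g (tail G a), g (head G a))) ` arcs H"
    proof (intro equalityI subrelI)
      fix i j assume ij: "(i, j) \<in> E \<union> E\<inverse>"
      then have V: "i \<in> V" "j \<in> V"
        using assms(2) by auto
      then have "f i \<rightarrow>\<^bsub>G\<^esub> f j"
        using ij edge by auto
      then obtain e where "e \<in> arcs G" "tail G e = f i" "head G e = f j"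
        by auto
      then show "(i, j) \<in> (\<lambda>a. (g (tail G a), g (head G a))) ` arcs H"
        using V by (auto simp: H_def g intro!: rev_image_eqI[of e])
    next
      fix i j assume "(i, j) \<in> (\<lambda>a. (g (tail G a), g (head G a))) ` arcs H"
      then obtain e i' j' where e: "e \<in> arcs G" "tail G e = f i'" "head G e = f j'"
        and V: "i' \<in> V" "j' \<in> V" and ij: "i = g (f i')" "j = g (f j')"
        by (auto simp: H_def)
      from e have "f i' \<rightarrow>\<^bsub>G\<^esub> f j'"
        by (metis dominatesI arc_to_ends_def)
      then show "(i, j) \<in> E \<union> E\<inverse>"
        using edge V ij g by auto
    qed
    moreover have "V = g ` f ` V"
      by (force simp: g)
    ultimately show ?thesis
      by (simp add: simple_graph_def with_proj_def app_iso_def hom_def) (simp add: H_def)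
  qed
  ultimately show "contains_induced G (simple_graph V E)"
    using H by (auto simp: contains_induced_def digraph_iso_def)
qed

section \<open>Recognising the three forbidden graphs\<close>

lemma atLeast0LessThan_4: "{0..<4::nat} = {0, 1, 2, 3}"
  and atLeast0LessThan_6: "{0..<6::nat} = {0, 1, 2, 3, 4, 5}"
  by auto

text \<open>Indexing into the list of vertices is the embedding. One orientation of each pair is
  assumed; the other follows by symmetry, and the diagonal by the absence of loops.
  \<open>P6\<close> and \<open>T33\<close> are treated alike.\<close>

lemma contains_induced_C4I:
  assumes "graph G" "distinct [a, b, c, d]"
    and "a \<rightarrow>\<^bsub>G\<^esub> b" "b \<rightarrow>\<^bsub>G\<^esub> c" "c \<rightarrow>\<^bsub>G\<^esub> d" "d \<rightarrow>\<^bsub>G\<^esub> a" "\<not> a \<rightarrow>\<^bsub>G\<^esub> c" "\<not> b \<rightarrow>\<^bsub>G\<^esub> d"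
  shows "contains_induced G C4"
proof -
  interpret graph G by fact
  have ends: "{a, b, c, d} \<subseteq> verts G"
    using assms adj_in_verts by blast
  show ?thesis
    unfolding C4_def
    by (subst contains_induced_simple_graph_iff[OF assms(1)], force,
        intro exI[of _ "(!) [a, b, c, d]"])
      (use assms ends in \<open>auto simp: atLeast0LessThan_4 dominates_sym not_dominates_self\<close>)
qed

lemma contains_induced_P6I:
  assumes "graph G" "distinct [a, b, c, d, e, f]"
    and "a \<rightarrow>\<^bsub>G\<^esub> b" "b \<rightarrow>\<^bsub>G\<^esub> c" "c \<rightarrow>\<^bsub>G\<^esub> d" "d \<rightarrow>\<^bsub>G\<^esub> e" "e \<rightarrow>\<^bsub>G\<^esub> f"
    and "\<not> a \<rightarrow>\<^bsub>G\<^esub> c" "\<not> a \<rightarrow>\<^bsub>G\<^esub> d" "\<not> a \<rightarrow>\<^bsub>G\<^esub> e" "\<not> a \<rightarrow>\<^bsub>G\<^esub> f" "\<not> b \<rightarrow>\<^bsub>G\<^esub> d" "\<not> b \<rightarrow>\<^bsub>G\<^esub> e"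
      "\<not> b \<rightarrow>\<^bsub>G\<^esub> f" "\<not> c \<rightarrow>\<^bsub>G\<^esub> e" "\<not> c \<rightarrow>\<^bsub>G\<^esub> f" "\<not> d \<rightarrow>\<^bsub>G\<^esub> f"
  shows "contains_induced G P6"
proof -
  interpret graph G by fact
  have ends: "{a, b, c, d, e, f} \<subseteq> verts G"
    using assms adj_in_verts by blast
  show ?thesis
    unfolding P6_def
    by (subst contains_induced_simple_graph_iff[OF assms(1)], force,
        intro exI[of _ "(!) [a, b, c, d, e, f]"])
      (use assms ends in \<open>auto simp: atLeast0LessThan_6 dominates_sym not_dominates_self\<close>)
qed

lemma contains_induced_T33I:
  assumes "graph G" "distinct [a, b, c, x, y, z]"
    and "a \<rightarrow>\<^bsub>G\<^esub> b" "b \<rightarrow>\<^bsub>G\<^esub> c" "c \<rightarrow>\<^bsub>G\<^esub> a" "a \<rightarrow>\<^bsub>G\<^esub> x" "x \<rightarrow>\<^bsub>G\<^esub> y" "y \<rightarrow>\<^bsub>G\<^esub> z"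
    and "\<not> a \<rightarrow>\<^bsub>G\<^esub> y" "\<not> a \<rightarrow>\<^bsub>G\<^esub> z" "\<not> b \<rightarrow>\<^bsub>G\<^esub> x" "\<not> b \<rightarrow>\<^bsub>G\<^esub> y" "\<not> b \<rightarrow>\<^bsub>G\<^esub> z"
      "\<not> c \<rightarrow>\<^bsub>G\<^esub> x" "\<not> c \<rightarrow>\<^bsub>G\<^esub> y" "\<not> c \<rightarrow>\<^bsub>G\<^esub> z" "\<not> x \<rightarrow>\<^bsub>G\<^esub> z"
  shows "contains_induced G T33"
proof -
  interpret graph G by fact
  have ends: "{a, b, c, x, y, z} \<subseteq> verts G"
    using assms adj_in_verts by blast
  show ?thesis
    unfolding T33_def
    by (subst contains_induced_simple_graph_iff[OF assms(1)], force,
        intro exI[of _ "(!) [a, b, c, x, y, z]"])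
      (use assms ends in \<open>auto simp: atLeast0LessThan_6 dominates_sym not_dominates_self\<close>)
qed


subsection \<open>Suitable roots\<close>

text \<open>
  For connected \<open>G\<close>, some \<open>cen\<close> satisfies this iff every component of \<open>G - r\<close> is a star with a
  centre adjacent to \<open>r\<close>; \<open>cen\<close> maps each vertex to the centre of its component. Only edges are
  constrained, so \<open>cen\<close> is arbitrary on one-vertex components.
\<close>

definition central_root :: "('a, 'b) pre_digraph \<Rightarrow> 'a \<Rightarrow> ('a \<Rightarrow> 'a) \<Rightarrow> bool" where
  "central_root G r cen \<longleftrightarrow> (\<forall>u v. u \<rightarrow>\<^bsub>G\<^esub> v \<and> u \<noteq> r \<and> v \<noteq> r \<longrightarrow>
    cen u = cen v \<and> cen u \<in> {u, v} \<and> r \<rightarrow>\<^bsub>G\<^esub> cen u)"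

text \<open>Choose a component for each vertex and a centre for each component. The ends of an edge
  avoiding \<open>r\<close> get the same component, hence the same centre.\<close>

lemma central_root_of_star_components:
  assumes "graph G"
    and star: "\<And>C. C \<in> components (pre_digraph.del_vert G r) \<Longrightarrow>
      \<exists>c. star_center C c \<and> r \<rightarrow>\<^bsub>G\<^esub> c"
  shows "\<exists>cen. central_root G r cen"
proof -
  interpret deleted_vertex G r
    using assms(1) by (simp add: deleted_vertex_def)
  obtain c where c: "\<And>C. C \<in> comps \<Longrightarrow> star_center C (c C) \<and> r \<rightarrow>\<^bsub>G\<^esub> c C"
    using star by metis
  obtain comp where comp: "\<And>v. v \<in> verts G \<Longrightarrow> v \<noteq> r \<Longrightarrow> comp v \<in> comps \<and> v \<in> verts (comp v)"
    using comp_exists by metis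
  have "central_root G r (\<lambda>v. c (comp v))"
    unfolding central_root_def
  proof (intro allI impI, elim conjE)
    fix u v assume uv: "u \<rightarrow>\<^bsub>G\<^esub> v" "u \<noteq> r" "v \<noteq> r"
    then have C: "comp u \<in> comps" "u \<in> verts (comp u)" "comp v \<in> comps" "v \<in> verts (comp v)"
      using comp adj_in_verts by blast+
    then have v: "v \<in> verts (comp u)"
      using comp_closed uv by blast
    then have "comp u = comp v"
      using comp_eq C by blast
    moreover have "u \<rightarrow>\<^bsub>comp u\<^esub> v"
      using comp_dominates_iff C v uv by blast
    ultimately show "c (comp u) = c (comp v) \<and> c (comp u) \<in> {u, v} \<and> r \<rightarrow>\<^bsub>G\<^esub> c (comp u)"
      using c[OF C(1)] unfolding star_center_def by (metis insertCI)
  qed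
  then show ?thesis by blast
qed

text \<open>\<open>cen\<close> is constant along the edges of \<open>C\<close>, hence on all of
  \<open>C\<close>; if \<open>C\<close> has an edge, the common value is the centre.\<close>

lemma star_components_of_central_root:
  assumes "graph G" "connected G" "r \<in> verts G" "central_root G r cen"
    and C: "C \<in> components (pre_digraph.del_vert G r)"
  shows "\<exists>c. star_center C c \<and> r \<rightarrow>\<^bsub>G\<^esub> c"
proof -
  interpret deleted_vertex G r
    using assms(1) by (simp add: deleted_vertex_def)
  have edge: "cen u = cen v \<and> cen u \<in> {u, v} \<and> r \<rightarrow>\<^bsub>G\<^esub> cen u" if "u \<rightarrow>\<^bsub>C\<^esub> v" for u v
    using that assms(4) comp_dominates_iff[OF C] comp_verts[OF C] unfolding central_root_def by blast
  show ?thesis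
  proof (cases "\<exists>u v. u \<rightarrow>\<^bsub>C\<^esub> v")
    case True
    then obtain u v where uv: "u \<rightarrow>\<^bsub>C\<^esub> v" by blast
    then have verts: "u \<in> verts C" "v \<in> verts C"
      using comp_dominates_iff[OF C] by blast+
    have const: "cen w = cen u" if "w \<in> verts C" for w
      using connected_induct[OF comp_graph[OF C] comp_connected[OF C] that verts(1),
          of "\<lambda>w. cen w = cen u"] edge by metis
    have "x = cen u \<or> y = cen u" if "x \<rightarrow>\<^bsub>C\<^esub> y" for x y
      using edge[OF that] const that comp_dominates_iff[OF C] by auto
    then have "star_center C (cen u)"
      using edge[OF uv] verts by (auto simp: star_center_def)
    then show ?thesis
      using edge[OF uv] by blast
  next
    case False
    \<comment> \<open>In a component without edges any vertex is a centre, so a neighbour of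
      \<open>r\<close> serves.\<close>
    moreover obtain v where "v \<in> verts C" "r \<rightarrow>\<^bsub>G\<^esub> v"
      using comp_root_neighbour[OF assms(2,3) C] by blast
    ultimately show ?thesis
      by (auto simp: star_center_def)
  qed
qed

section \<open>A suitable root excludes the forbidden graphs\<close>

lemma central_root_path:
  assumes "central_root G r cen" "u \<rightarrow>\<^bsub>G\<^esub> v" "v \<rightarrow>\<^bsub>G\<^esub> w" "u \<noteq> w" "\<not> u \<rightarrow>\<^bsub>G\<^esub> w" "r \<notin> {u, v, w}"
  shows "r \<rightarrow>\<^bsub>G\<^esub> v"
  \<comment> \<open>Both edges have the same value of \<open>cen\<close>, which lies in
    \<open>{u, v}\<close> and in \<open>{v, w}\<close> and so is \<open>v\<close>.\<close>
  using assms unfolding central_root_def by (metis insertE insertI1 insertI2 singletonD)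

text \<open>If \<open>r\<close> is avoided, one value of \<open>cen\<close> would lie on the
  disjoint edges \<open>ab\<close> and \<open>cd\<close>. Chords are allowed, so 4-cycles are
  covered.\<close>

lemma central_root_no_path4:
  assumes "central_root G r cen" "a \<rightarrow>\<^bsub>G\<^esub> b" "b \<rightarrow>\<^bsub>G\<^esub> c" "c \<rightarrow>\<^bsub>G\<^esub> d" "distinct [a, b, c, d]"
  shows "r \<in> {a, b, c, d}"
proof (rule ccontr)
  assume r: "r \<notin> {a, b, c, d}"
  then have "cen a = cen b" "cen b = cen c" "cen a \<in> {a, b}" "cen c \<in> {c, d}"
    using assms(1-4) unfolding central_root_def by auto
  then show False using assms(5) by auto
qed

text \<open>No vertex lies on all three edges of a triangle.\<close>

lemma central_root_no_triangle:
  assumes "central_root G r cen" "a \<rightarrow>\<^bsub>G\<^esub> b" "b \<rightarrow>\<^bsub>G\<^esub> c" "c \<rightarrow>\<^bsub>G\<^esub> a" "distinct [a, b, c]"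
  shows "r \<in> {a, b, c}"
proof (rule ccontr)
  assume r: "r \<notin> {a, b, c}"
  then have "cen a = cen b" "cen b = cen c" "cen a \<in> {a, b}" "cen b \<in> {b, c}" "cen c \<in> {c, a}"
    using assms(1-4) unfolding central_root_def by auto
  then show False using assms(5) by auto
qed

text \<open>The root must lie on the cycle. The other three vertices then form an induced path whose
  middle, opposite to the root, would be adjacent to it.\<close>

lemma central_root_not_contains_C4:
  assumes "graph G" "central_root G r cen"
  shows "\<not> contains_induced G C4"
proof
  assume "contains_induced G C4"
  then obtain f :: "nat \<Rightarrow> 'a" where inj: "inj_on f {0, 1, 2, 3}"
    and e: "\<forall>i\<in>{0, 1, 2, 3}. \<forall>j\<in>{0, 1, 2, 3}. f i \<rightarrow>\<^bsub>G\<^esub> f j \<longleftrightarrow>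
      (i, j) \<in> {(0, 1), (1, 2), (2, 3), (3, 0)} \<or> (j, i) \<in> {(0, 1), (1, 2), (2, 3), (3, 0)}"
    unfolding C4_def
    by (subst (asm) contains_induced_simple_graph_iff[OF assms(1)])
      (force, auto simp: atLeast0LessThan_4)
  have ne: "distinct [f 0, f 1, f 2, f 3]" "distinct [f 3, f 2, f 1, f 0]"
    using inj by (auto simp: inj_on_def)
  have "r \<in> {f 0, f 1, f 2, f 3}"
    using central_root_no_path4[OF assms(2), of "f 0" "f 1" "f 2" "f 3"] e ne by simp
  then show False
    using central_root_path[OF assms(2), of "f 1" "f 2" "f 3"]
      central_root_path[OF assms(2), of "f 2" "f 3" "f 0"]
      central_root_path[OF assms(2), of "f 3" "f 0" "f 1"]
      central_root_path[OF assms(2), of "f 0" "f 1" "f 2"] e ne by auto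
qed

text \<open>The root meets both the first four and the last four vertices, so it is one of the two
  middle ones. The three vertices on the longer side contain an induced path whose middle, at
  distance two, would be adjacent to it.\<close>

lemma central_root_not_contains_P6:
  assumes "graph G" "central_root G r cen"
  shows "\<not> contains_induced G P6"
proof
  assume "contains_induced G P6"
  then obtain f :: "nat \<Rightarrow> 'a" where inj: "inj_on f {0, 1, 2, 3, 4, 5}"
    and e: "\<forall>i\<in>{0, 1, 2, 3, 4, 5}. \<forall>j\<in>{0, 1, 2, 3, 4, 5}. f i \<rightarrow>\<^bsub>G\<^esub> f j \<longleftrightarrow>
      (i, j) \<in> {(0, 1), (1, 2), (2, 3), (3, 4), (4, 5)} \<or>
      (j, i) \<in> {(0, 1), (1, 2), (2, 3), (3, 4), (4, 5)}"
    unfolding P6_def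
    by (subst (asm) contains_induced_simple_graph_iff[OF assms(1)])
      (force, auto simp: atLeast0LessThan_6)
  have ne: "distinct [f 0, f 1, f 2, f 3, f 4, f 5]" "distinct [f 5, f 4, f 3, f 2, f 1, f 0]"
    using inj by (auto simp: inj_on_def)
  have "r \<in> {f 0, f 1, f 2, f 3}" "r \<in> {f 2, f 3, f 4, f 5}"
    using central_root_no_path4[OF assms(2), of "f 0" "f 1" "f 2" "f 3"]
      central_root_no_path4[OF assms(2), of "f 2" "f 3" "f 4" "f 5"] e ne by simp_all
  then consider "r = f 2" | "r = f 3"
    using ne by auto
  then show False
  proof cases
    case 1
    then show False
      using central_root_path[OF assms(2), of "f 3" "f 4" "f 5"] e ne by simp
  next
    case 2
    then show False
      using central_root_path[OF assms(2), of "f 2" "f 1" "f 0"] e ne by simp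
  qed
qed

text \<open>The triangle and the path \<open>0, 3, 4, 5\<close> meet only in \<open>0\<close>, so
  the root is there; the path \<open>3, 4, 5\<close> would then make it adjacent to
  \<open>4\<close>.\<close>

lemma central_root_not_contains_T33:
  assumes "graph G" "central_root G r cen"
  shows "\<not> contains_induced G T33"
proof
  assume "contains_induced G T33"
  then obtain f :: "nat \<Rightarrow> 'a" where inj: "inj_on f {0, 1, 2, 3, 4, 5}"
    and e: "\<forall>i\<in>{0, 1, 2, 3, 4, 5}. \<forall>j\<in>{0, 1, 2, 3, 4, 5}. f i \<rightarrow>\<^bsub>G\<^esub> f j \<longleftrightarrow>
      (i, j) \<in> {(0, 1), (1, 2), (2, 0), (0, 3), (3, 4), (4, 5)} \<or>
      (j, i) \<in> {(0, 1), (1, 2), (2, 0), (0, 3), (3, 4), (4, 5)}"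
    unfolding T33_def
    by (subst (asm) contains_induced_simple_graph_iff[OF assms(1)])
      (force, auto simp: atLeast0LessThan_6)
  have ne: "distinct [f 0, f 1, f 2, f 3, f 4, f 5]" "distinct [f 5, f 4, f 3, f 2, f 1, f 0]"
    using inj by (auto simp: inj_on_def)
  have "r \<in> {f 0, f 1, f 2}" "r \<in> {f 0, f 3, f 4, f 5}"
    using central_root_no_triangle[OF assms(2), of "f 0" "f 1" "f 2"]
      central_root_no_path4[OF assms(2), of "f 0" "f 3" "f 4" "f 5"] e ne by simp_all
  then have "r = f 0"
    using ne by auto
  then show False
    using central_root_path[OF assms(2), of "f 3" "f 4" "f 5"] e ne by simp
qed


text \<open>Either \<open>r\<close> is suitable, or the root moves to the neighbour \<open>l\<close>
  of \<open>r\<close> in a component \<open>C\<close> that has no centre adjacent to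
  \<open>r\<close>.\<close>

lemma central_root_exists:
  assumes "graph G" "connected G" "r \<in> verts G"
    and star: "\<And>C. C \<in> components (pre_digraph.del_vert G r) \<Longrightarrow> \<exists>c. star_center C c"
    and free: "\<not> contains_induced G C4" "\<not> contains_induced G P6" "\<not> contains_induced G T33"
  shows "\<exists>r \<in> verts G. \<exists>cen. central_root G r cen"
proof (cases "\<forall>C \<in> components (pre_digraph.del_vert G r). \<exists>c. star_center C c \<and> r \<rightarrow>\<^bsub>G\<^esub> c")
  case True
  then show ?thesis
    using central_root_of_star_components[OF assms(1), of r] assms(3) by metis
next
  case False
  interpret deleted_vertex G r
    using assms(1) by (simp add: deleted_vertex_def)
  obtain C where C: "C \<in> comps" and bad: "\<And>c. star_center C c \<Longrightarrow> \<not> r \<rightarrow>\<^bsub>G\<^esub> c"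
    using False by metis
  obtain c where c: "star_center C c"
    using star C by metis
  obtain l where l: "l \<in> verts C" "r \<rightarrow>\<^bsub>G\<^esub> l"
    using comp_root_neighbour[OF assms(2,3) C] by blast
  have cC: "c \<in> verts C"
    using c by (simp add: star_center_def)
  have rC: "r \<notin> verts C"
    using comp_verts[OF C] by blast
  have edgeC: "u = c \<or> v = c" if "u \<rightarrow>\<^bsub>G\<^esub> v" "u \<in> verts C" "v \<in> verts C" for u v
    using c that comp_dominates_iff[OF C] unfolding star_center_def by blast
  have spoke: "c \<rightarrow>\<^bsub>G\<^esub> v" if "v \<in> verts C" "v \<noteq> c" for v
    using star_center_dominates[OF comp_graph[OF C] comp_connected[OF C] c that]
      comp_dominates_iff[OF C] by blast
  have rc: "\<not> r \<rightarrow>\<^bsub>G\<^esub> c"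
    using bad c by blast
  then have "l \<noteq> c"
    using l by blast
  \<comment> \<open>As a neighbour of \<open>r\<close>, \<open>l\<close> is no centre of
    \<open>C\<close>. Some edge of \<open>C\<close> therefore misses \<open>l\<close>, and one of
    its two ends differs from \<open>c\<close>.\<close>
  obtain l' where l': "l' \<in> verts C" "l' \<noteq> l" "l' \<noteq> c"
  proof -
    have "\<not> star_center C l"
      using bad l by blast
    then obtain u v where "u \<rightarrow>\<^bsub>C\<^esub> v" "u \<noteq> l" "v \<noteq> l"
      using l by (auto simp: star_center_def)
    moreover from this have "u \<noteq> v" "u \<in> verts C" "v \<in> verts C"
      using comp_dominates_iff[OF C] not_dominates_self by blast+
    ultimately show ?thesis
      using that by metis
  qed
  \<comment> \<open>A second neighbour \<open>v\<close> of \<open>r\<close> in \<open>C\<close>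
    would close the 4-cycle \<open>r, l, c, v\<close>. It has no chord: \<open>c\<close> is not
    adjacent to \<open>r\<close>, and \<open>l\<close> and \<open>v\<close> are leaves.\<close>
  have unique: "v = l" if v: "v \<in> verts C" "r \<rightarrow>\<^bsub>G\<^esub> v" for v
  proof (rule ccontr)
    assume "v \<noteq> l"
    moreover have "v \<noteq> c" using v rc by blast
    moreover have "\<not> l \<rightarrow>\<^bsub>G\<^esub> v"
      using edgeC l v \<open>l \<noteq> c\<close> \<open>v \<noteq> c\<close> by blast
    moreover have "l \<rightarrow>\<^bsub>G\<^esub> c" "c \<rightarrow>\<^bsub>G\<^esub> v" "v \<rightarrow>\<^bsub>G\<^esub> r"
      using spoke l(1) v \<open>l \<noteq> c\<close> \<open>v \<noteq> c\<close> dominates_sym by blast+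
    ultimately have "contains_induced G C4"
      using l v rc rC cC \<open>l \<noteq> c\<close>
      by (intro contains_induced_C4I[OF assms(1), of r l c v]) auto
    then show False using free by blast
  qed
  have path: "r \<rightarrow>\<^bsub>G\<^esub> l" "l \<rightarrow>\<^bsub>G\<^esub> c" "c \<rightarrow>\<^bsub>G\<^esub> l'" "\<not> r \<rightarrow>\<^bsub>G\<^esub> c" "\<not> r \<rightarrow>\<^bsub>G\<^esub> l'" "\<not> l \<rightarrow>\<^bsub>G\<^esub> l'"
    using l spoke l' rc unique edgeC \<open>l \<noteq> c\<close> dominates_sym by blast+
  \<comment> \<open>Outside \<open>C\<close> every edge contains \<open>r\<close>: an edge avoiding
    \<open>r\<close> would lie in another component \<open>D\<close> and extend the induced path
    \<open>r, l, c, l'\<close>.\<close>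
  have outside: "x = r" if x: "v \<rightarrow>\<^bsub>G\<^esub> x" "v \<notin> verts C" "v \<noteq> r" for v x
  proof (rule ccontr)
    assume "x \<noteq> r"
    obtain D where D: "D \<in> comps" "v \<in> verts D"
      using comp_exists x adj_in_verts by blast
    obtain d where d: "d \<in> verts D" "r \<rightarrow>\<^bsub>G\<^esub> d"
      using comp_root_neighbour[OF assms(2,3) D(1)] by blast
    \<comment> \<open>If \<open>d\<close> were isolated in \<open>D\<close>, connectedness would
      give \<open>D\<close> the single vertex \<open>d\<close>, but \<open>v\<close> and
      \<open>x\<close> are distinct vertices of \<open>D\<close>.\<close>
    have "\<exists>d'. d \<rightarrow>\<^bsub>D\<^esub> d'"
    proof (rule ccontr)
      assume no: "\<not> ?thesis"
      have "w = d" if "w \<in> verts D" for w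
        using connected_induct[OF comp_graph[OF D(1)] comp_connected[OF D(1)] that d(1),
            of "\<lambda>w. w = d"] no by blast
      moreover have "x \<in> verts D"
        using comp_closed[OF D x(1)] \<open>x \<noteq> r\<close> by blast
      ultimately have "v = x"
        using D(2) by metis
      then show False using x not_dominates_self by blast
    qed
    then obtain d' where d': "d' \<in> verts D" "d \<rightarrow>\<^bsub>G\<^esub> d'"
      using comp_dominates_iff[OF D(1)] by blast
    have disj: "w \<notin> verts D" if "w \<in> verts C" for w
      using comp_eq[OF C D(1) that] D(2) x(2) by blast
    have sep: "\<not> y \<rightarrow>\<^bsub>G\<^esub> w" if "y \<in> verts D" "w \<in> verts C" for y w
      using comp_closed[OF D(1) that(1)] disj[OF that(2)] that(2) rC by blast
    have "r \<notin> verts D"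
      using comp_verts[OF D(1)] by blast
    have dist: "distinct [d', d, r, l, c, l']"
      using disj[OF l(1)] disj[OF cC] disj[OF l'(1)] d d' l' \<open>l \<noteq> c\<close> rC l(1) cC \<open>r \<notin> verts D\<close>
        not_dominates_self by auto
    have nonadj: "\<not> d \<rightarrow>\<^bsub>G\<^esub> l" "\<not> d \<rightarrow>\<^bsub>G\<^esub> c" "\<not> d \<rightarrow>\<^bsub>G\<^esub> l'" "\<not> d' \<rightarrow>\<^bsub>G\<^esub> l" "\<not> d' \<rightarrow>\<^bsub>G\<^esub> c" "\<not> d' \<rightarrow>\<^bsub>G\<^esub> l'"
      using sep d d' l(1) l'(1) cC by blast+
    show False
    \<comment> \<open>If \<open>d'\<close> is adjacent to \<open>r\<close>, then
      \<open>r, d, d'\<close> is a triangle with tail \<open>l, c, l'\<close>; otherwise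
      \<open>d', d, r, l, c, l'\<close> is an induced path.\<close>
    proof (cases "d' \<rightarrow>\<^bsub>G\<^esub> r")
      case True
      then have "contains_induced G T33"
        using dist nonadj path d d'
        by (intro contains_induced_T33I[OF assms(1), of r d d' l c l']) auto
      then show False using free by blast
    next
      case False
      moreover have "d' \<rightarrow>\<^bsub>G\<^esub> d" "d \<rightarrow>\<^bsub>G\<^esub> r"
        using d d' dominates_sym by blast+
      ultimately have "contains_induced G P6"
        using dist nonadj path
        by (intro contains_induced_P6I[OF assms(1), of d' d r l c l']) auto
      then show False using free by blast
    qed
  qed
  have lr: "l \<rightarrow>\<^bsub>G\<^esub> r"
    using l dominates_sym by blast
  \<comment> \<open>After deletion of \<open>l\<close>, the rest of \<open>C\<close> is covered by
    the star at \<open>c\<close> and everything else by the star at \<open>r\<close>; both centres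
    are neighbours of \<open>l\<close>.\<close>
  have "central_root G l (\<lambda>v. if v \<in> verts C then c else r)"
    unfolding central_root_def
  proof (intro allI impI, elim conjE)
    fix u v assume uv: "u \<rightarrow>\<^bsub>G\<^esub> v" "u \<noteq> l" "v \<noteq> l"
    then have vu: "v \<rightarrow>\<^bsub>G\<^esub> u"
      using dominates_sym by blast
    show "(if u \<in> verts C then c else r) = (if v \<in> verts C then c else r) \<and>
        (if u \<in> verts C then c else r) \<in> {u, v} \<and> l \<rightarrow>\<^bsub>G\<^esub> (if u \<in> verts C then c else r)"
    proof (cases "u \<in> verts C")
      case True
      then have "v \<noteq> r"
        using unique uv vu by blast
      then have "v \<in> verts C"
        using comp_closed[OF C True uv(1)] by blast
      then show ?thesis
        using True edgeC[OF uv(1)] path(2) by auto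
    next
      case False
      \<comment> \<open>An edge entering \<open>C\<close> from outside starts at \<open>r\<close>,
        and its end in \<open>C\<close> would then be \<open>l\<close>.\<close>
      have "v \<notin> verts C"
        using False comp_closed[OF C _ vu] unique uv by blast
      then show ?thesis
        using False outside[OF uv(1)] lr by auto
    qed
  qed
  moreover have "l \<in> verts G"
    using l adj_in_verts by blast
  ultimately show ?thesis by blast
qed

text \<open>The infimum for \<open>mtd\<close> runs over a subset of the trees for
  \<open>td\<close>. This gives the bound from below once a matched tree of depth at most 3 is
  found.\<close>

lemma td_le_mtd: "td G \<le> mtd G"
  unfolding td_def mtd_def
  by (rule INF_superset_mono) (auto simp: matched_elimination_tree_def)

theorem theorem5:
  fixes G :: "('a, 'b) pre_digraph"
  assumes "graph G"
    and "connected G"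
    and "td G = 3"
  shows "mtd G = 3 \<longleftrightarrow>
    \<not> contains_induced G C4 \<and> \<not> contains_induced G P6 \<and> \<not> contains_induced G T33"
proof
  assume "mtd G = 3"
  \<comment> \<open>A strict bound on the infimum yields an actual tree below it.\<close>
  then have "mtd G < enat 4"
    by (simp add: numeral_eq_enat)
  then obtain t where t: "matched_elimination_tree G t" "depth t < 4"
    unfolding mtd_def INF_less_iff by auto
  obtain r ts where node: "t = Node r ts"
    by (cases t)
  have d: "depth (Node r ts) \<le> 3" and m: "matched_elimination_tree G (Node r ts)"
    using t node by auto
  have tree: "elimination_tree G (Node r ts)"
    using m by (simp add: matched_elimination_tree_def)
  \<comment> \<open>The root of one subtree is both a centre of \<open>C\<close> and, by the
    matching, a neighbour of \<open>r\<close>.\<close>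
  have "\<exists>c. star_center C c \<and> r \<rightarrow>\<^bsub>G\<^esub> c" if "C \<in> components (pre_digraph.del_vert G r)" for C
    using elimination_tree_depth_le_3[OF assms(1) tree d that]
      matched_elimination_tree_root_dominates[OF m d] by metis
  then obtain cen where "central_root G r cen"
    using central_root_of_star_components[OF assms(1)] by metis
  then show "\<not> contains_induced G C4 \<and> \<not> contains_induced G P6 \<and> \<not> contains_induced G T33"
    using assms(1) central_root_not_contains_C4 central_root_not_contains_P6
      central_root_not_contains_T33 by metis
next
  assume free: "\<not> contains_induced G C4 \<and> \<not> contains_induced G P6 \<and> \<not> contains_induced G T33"
  have "td G < enat 4"
    using assms(3) by (simp add: numeral_eq_enat)
  then obtain t where t: "elimination_tree G t" "depth t < 4"
    unfolding td_def INF_less_iff by auto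
  obtain r ts where node: "t = Node r ts"
    by (cases t)
  have "\<exists>c. star_center C c" if "C \<in> components (pre_digraph.del_vert G r)" for C
    using elimination_tree_depth_le_3[OF assms(1) t(1)[unfolded node] _ that] t(2) node by auto
  moreover have "r \<in> verts G"
    using elimination_tree_root[OF t(1)] node by simp
  ultimately obtain q cen where q: "q \<in> verts G" "central_root G q cen"
    using central_root_exists[OF assms(1,2)] free by metis
  \<comment> \<open>A one-vertex graph has no matched tree, but its tree depth is at most 1, against
    \<open>td G = 3\<close>.\<close>
  have "verts G \<noteq> {q}"
  proof
    assume "verts G = {q}"
    then have "elimination_tree G (Node q {||})"
      by (rule singleton_elimination_tree[OF assms(1,2)])
    then have "td G \<le> enat (depth (Node q {||}))"
      unfolding td_def by (intro INF_lower) simp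
    moreover have "depth (Node q {||}) \<le> 1"
      by (simp add: depth_le_iff root_to_leaf_path_Node_iff)
    ultimately show False
      using assms(3) by (simp add: numeral_eq_enat)
  qed
  then obtain t' where "matched_elimination_tree G t'" "depth t' \<le> 3"
    using matched_elimination_tree_of_star_components[OF assms(1,2) q(1)]
      star_components_of_central_root[OF assms(1,2) q] by metis
  then have "mtd G \<le> 3"
    unfolding mtd_def by (intro INF_lower2[of t']) (auto simp: numeral_eq_enat)
  then show "mtd G = 3"
    using td_le_mtd[of G] assms(3) by simp
qed

end
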